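(* Fix an integer $a\ge 2$ and a constant $g>0$. Then there exist a constant $c>0$ and an integer $n_0$ such that for every integer $n\ge n_0$ the following holds. Every $g$-approximate formulation in the natural encoding for metric capacitated facility location with $n^2$ facilities, $an^4$ clients of unit demand and uniform facility capacity $U=n^3$ (that is, every system of linear inequalities $A(y,x)\le b$ in the variables $(y,x)\in\mathbb{R}^{n^2+an^6}$ that is such a formulation) has at least $2^{c\,n\log n}$ constraints. In other words, every approximate formulation for metric capacitated facility location that uses the natural encoding and has integrality gap at most a constant $g$ has $2^{\Omega(n\log n)}$ constraints.
   Context: Metric capacitated facility location (CFL), natural encoding. Let $F$ be the set of facilities, with $|F|=n^2$, and $C$ the set of clients, with $|C|=an^4$; each client has demand $1$ and each facility has capacity $U=n^3$. The variables are $y_i$ ($i\in F$; facility opening) and $x_{ij}$ ($i\in F$, $j\in C$; assignment of client $j$ to facility $i$), so the dimension is $d=n^2+an^6$. The set $P_0$ of feasible integer solutions consists of all $(y,x)\in\{0,1\}^d$ such that every client is assigned to exactly one facility ($\sum_{i\in F}x_{ij}=1$ for all $j\in C$), clients are assigned only to open facilities ($x_{ij}\le y_i$ for all $i,j$), and capacities are respected ($\sum_{j\in C}x_{ij}\le U$ for all $i\in F$). Let $P=\operatorname{conv}(P_0)$. The set $O_d$ of admissible objective functions consists of all pairs $w=(\mathbf f,\mathbf c)$ with opening costs $\mathbf f\in\mathbb{R}_{+}^{F}$ and connection costs $\mathbf c=[c_{ij}]\in\mathbb{R}_{+}^{F\times C}$ satisfying $c_{ij}\le c_{i'j}+c_{i'j'}+c_{ij'}$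 for all $i,i'\in F$, $j,j'\in C$. The cost of $(y,x)$ is $w^T(y,x)=\sum_i f_iy_i+\sum_{i,j}c_{ij}x_{ij}$. A system of linear inequalities $Az\le b$ with $z=(y,x)\in\mathbb{R}^d$ (only these variables, no additional ones) is a $g$-approximate formulation that uses the natural encoding (equivalently, an approximate formulation with integrality gap at most $g$) if $$\min\{w^Tz\mid Az\le b\}\le\min\{w^Tz\mid z\in P\}\quad\text{for all } w\in\mathbb{R}^d,$$ $$\min\{w^Tz\mid Az\le b\}\ge g^{-1}\min\{w^Tz\mid z\in P\}\quad\text{for all } w\in O_d.$$ The number of constraints is the number of inequalities in $Az\le b$. *)

theory Defs
  imports "HOL-Analysis.Analysis" "HOL-Analysis.Finite_Function_Topology"
begin

text \<open>
  An instance has facilities \<open>{..<nf}\<close>, clients \<open>{..<nc}\<close> (unit demands) and uniform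
  capacity \<open>U\<close>. The number of coordinates depends on bound variables, so
  \<open>\<real>\<^sup>d\<close> is the subspace of finitely supported functions on \<open>cfl_var\<close> whose support lies in
  the \<open>d\<close> coordinates of the instance; this makes the library's \<open>convex hull\<close> available.
\<close>

datatype cfl_var = Opening nat | Assign nat nat

type_synonym cfl_vec = "(cfl_var, real) poly_mapping"

definition cfl_vars :: "nat \<Rightarrow> nat \<Rightarrow> cfl_var set" where
  "cfl_vars nf nc =
     {Opening i | i. i < nf} \<union> {Assign i j | i j. i < nf \<and> j < nc}"

definition cfl_space :: "nat \<Rightarrow> nat \<Rightarrow> cfl_vec set" where
  "cfl_space nf nc = {z. Poly_Mapping.keys z \<subseteq> cfl_vars nf nc}"

text \<open>
  Coefficient vectors (objectives and constraint rows) are plain functions; their values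
  outside the \<open>d\<close> coordinates of the instance are never used.
\<close>

definition cfl_dot :: "nat \<Rightarrow> nat \<Rightarrow> (cfl_var \<Rightarrow> real) \<Rightarrow> cfl_vec \<Rightarrow> real" where
  "cfl_dot nf nc w z = (\<Sum>v\<in>cfl_vars nf nc. w v * Poly_Mapping.lookup z v)"

definition cfl_int_solutions :: "nat \<Rightarrow> nat \<Rightarrow> nat \<Rightarrow> cfl_vec set" where
  "cfl_int_solutions nf nc U = {z \<in> cfl_space nf nc.
     (\<forall>v\<in>cfl_vars nf nc. Poly_Mapping.lookup z v \<in> {0, 1}) \<and>
     (\<forall>j<nc. (\<Sum>i<nf. Poly_Mapping.lookup z (Assign i j)) = 1) \<and>
     (\<forall>i<nf. \<forall>j<nc. Poly_Mapping.lookup z (Assign i j) \<le> Poly_Mapping.lookup z (Opening i)) \<and>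
     (\<forall>i<nf. (\<Sum>j<nc. Poly_Mapping.lookup z (Assign i j)) \<le> real U)}"

definition cfl_polytope :: "nat \<Rightarrow> nat \<Rightarrow> nat \<Rightarrow> cfl_vec set" where
  "cfl_polytope nf nc U = convex hull (cfl_int_solutions nf nc U)"

definition cfl_admissible :: "nat \<Rightarrow> nat \<Rightarrow> (cfl_var \<Rightarrow> real) set" where
  "cfl_admissible nf nc = {w.
     (\<forall>i<nf. 0 \<le> w (Opening i)) \<and>
     (\<forall>i<nf. \<forall>j<nc. 0 \<le> w (Assign i j)) \<and>
     (\<forall>i<nf. \<forall>i'<nf. \<forall>j<nc. \<forall>j'<nc.
        w (Assign i j) \<le> w (Assign i' j) + w (Assign i' j') + w (Assign i j'))}"

definition cfl_solution_set ::
  "nat \<Rightarrow> nat \<Rightarrow> nat \<Rightarrow> (nat \<Rightarrow> cfl_var \<Rightarrow> real) \<Rightarrow> (nat \<Rightarrow> real) \<Rightarrow> cfl_vec set" where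
  "cfl_solution_set nf nc m A b =
     {z \<in> cfl_space nf nc. \<forall>k<m. cfl_dot nf nc (A k) z \<le> b k}"

text \<open>
  Optimal value of a linear program with the usual conventions: \<open>-\<infinity>\<close> if the objective is
  unbounded below (possible here, since the first condition on a formulation ranges over all
  objectives) and \<open>\<infinity>\<close> if the program is infeasible. A finite value is attained for the
  polyhedra below, so it is the minimum.
\<close>

definition cfl_min :: "nat \<Rightarrow> nat \<Rightarrow> (cfl_var \<Rightarrow> real) \<Rightarrow> cfl_vec set \<Rightarrow> ereal" where
  "cfl_min nf nc w Q = (INF z\<in>Q. ereal (cfl_dot nf nc w z))"

definition cfl_approx_formulation ::
  "nat \<Rightarrow> nat \<Rightarrow> nat \<Rightarrow> real \<Rightarrow> nat \<Rightarrow> (nat \<Rightarrow> cfl_var \<Rightarrow> real) \<Rightarrow> (nat \<Rightarrow> real) \<Rightarrow> bool" where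
  "cfl_approx_formulation nf nc U g m A b \<longleftrightarrow>
     (\<forall>w. cfl_min nf nc w (cfl_solution_set nf nc m A b)
            \<le> cfl_min nf nc w (cfl_polytope nf nc U)) \<and>
     (\<forall>w\<in>cfl_admissible nf nc.
        cfl_min nf nc w (cfl_solution_set nf nc m A b)
            \<ge> ereal (inverse g) * cfl_min nf nc w (cfl_polytope nf nc U))"

lemma cfl_vars_alt:
  "cfl_vars nf nc = Opening ` {..<nf} \<union> case_prod Assign ` ({..<nf} \<times> {..<nc})"
  by (auto simp: cfl_vars_def)

lemma finite_cfl_vars [simp]: "finite (cfl_vars nf nc)"
  by (simp add: cfl_vars_alt)

lemma cfl_dot_split:
  "cfl_dot nf nc w z =
     (\<Sum>i<nf. w (Opening i) * Poly_Mapping.lookup z (Opening i)) +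
     (\<Sum>i<nf. \<Sum>j<nc. w (Assign i j) * Poly_Mapping.lookup z (Assign i j))"
proof -
  have "inj_on (case_prod Assign) ({..<nf} \<times> {..<nc})" "inj_on Opening {..<nf}"
    by (auto simp: inj_on_def)
  then show ?thesis
    unfolding cfl_dot_def cfl_vars_alt
    by (subst sum.union_disjoint)
       (auto simp: sum.reindex sum.cartesian_product intro!: sum.cong)
qed

lemma card_cfl_vars: "card (cfl_vars nf nc) = nf + nf * nc"
proof -
  have "inj_on (case_prod Assign) ({..<nf} \<times> {..<nc})" "inj_on Opening {..<nf}"
    by (auto simp: inj_on_def)
  then show ?thesis
    unfolding cfl_vars_alt
    by (subst card_Un_disjoint) (auto simp: card_image)
qed

end

theory Submission
  imports Defs
begin

text \<open>
  Fix a facility \<open>e\<close> and a set \<open>D\<close> of \<open>k U + 1\<close> clients; the remaining clients are assigned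
  integrally, once and for all, to facilities reserved for them. For every set \<open>S\<close> of \<open>k\<close> of
  the unreserved facilities let \<open>z\<^sub>S\<close> open all facilities but \<open>e\<close>, open \<open>e\<close> to the extent \<open>1 / U\<close>,
  and spread \<open>D\<close> uniformly over \<open>S\<close> (load \<open>U\<close> each) and \<open>e\<close> (load \<open>1\<close>). If \<open>S \<union> {e}\<close> and \<open>D\<close>
  are colocated at distance \<open>1\<close> from everything else and only \<open>e\<close> has a positive opening cost,
  namely \<open>1\<close>, then \<open>z\<^sub>S\<close> costs \<open>1 / U\<close>, whereas an integer solution must open \<open>e\<close> or move a
  client of \<open>D\<close>; so a formulation of gap less than \<open>U\<close> cuts off every \<open>z\<^sub>S\<close>. But the midpoint of
  any two points \<open>z\<^sub>S \<noteq> z\<^sub>T\<close> is a convex combination of integer solutions, so no valid inequality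
  cuts off more than one of them, and there are at least as many inequalities as sets \<open>S\<close>.
\<close>

section \<open>Vectors given by coordinate formulas\<close>

definition cfl_vec_of :: "nat \<Rightarrow> nat \<Rightarrow> (cfl_var \<Rightarrow> real) \<Rightarrow> cfl_vec" where
  "cfl_vec_of nf nc f = Abs_poly_mapping (\<lambda>v. if v \<in> cfl_vars nf nc then f v else 0)"

lemma lookup_cfl_vec_of:
  "Poly_Mapping.lookup (cfl_vec_of nf nc f) v = (if v \<in> cfl_vars nf nc then f v else 0)"
proof -
  have "finite {v. (if v \<in> cfl_vars nf nc then f v else 0) \<noteq> 0}"
    by (rule finite_subset[OF _ finite_cfl_vars[of nf nc]]) auto
  then show ?thesis
    unfolding cfl_vec_of_def by (simp add: lookup_Abs_poly_mapping)
qed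

lemma lookup_scaleR [simp]:
  "Poly_Mapping.lookup (r *\<^sub>R z) v = r * Poly_Mapping.lookup z v"
  for z :: "('a, real) poly_mapping"
proof -
  have "finite {v. r * Poly_Mapping.lookup z v \<noteq> 0}"
    by (rule finite_subset[OF _ finite_lookup[of z]]) auto
  then show ?thesis
    by (simp add: scaleR_poly_mapping_def lookup_Abs_poly_mapping)
qed

lemma Opening_in_cfl_vars [simp]: "Opening i \<in> cfl_vars nf nc \<longleftrightarrow> i < nf"
  and Assign_in_cfl_vars [simp]: "Assign i j \<in> cfl_vars nf nc \<longleftrightarrow> i < nf \<and> j < nc"
  by (auto simp: cfl_vars_def)

lemma cfl_vec_of_in_space: "cfl_vec_of nf nc f \<in> cfl_space nf nc"
  by (auto simp: cfl_space_def in_keys_iff lookup_cfl_vec_of split: if_splits)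

lemma cfl_vec_of_cong:
  assumes "\<And>i. i < nf \<Longrightarrow> f (Opening i) = f' (Opening i)"
    and "\<And>i j. i < nf \<Longrightarrow> j < nc \<Longrightarrow> f (Assign i j) = f' (Assign i j)"
  shows "cfl_vec_of nf nc f = cfl_vec_of nf nc f'"
  using assms by (intro poly_mapping_eqI) (auto simp: lookup_cfl_vec_of cfl_vars_def)

lemma cfl_vec_of_add:
  "cfl_vec_of nf nc f + cfl_vec_of nf nc f' = cfl_vec_of nf nc (\<lambda>v. f v + f' v)"
  by (intro poly_mapping_eqI) (simp add: lookup_add lookup_cfl_vec_of)

lemma cfl_vec_of_scaleR:
  "r *\<^sub>R cfl_vec_of nf nc f = cfl_vec_of nf nc (\<lambda>v. r * f v)"
  by (intro poly_mapping_eqI) (simp add: lookup_cfl_vec_of)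

lemma cfl_vec_of_sum:
  "(\<Sum>r\<in>R. cfl_vec_of nf nc (f r)) = cfl_vec_of nf nc (\<lambda>v. \<Sum>r\<in>R. f r v)"
  by (intro poly_mapping_eqI) (simp add: lookup_sum lookup_cfl_vec_of)

lemma cfl_dot_add: "cfl_dot nf nc w (z + z') = cfl_dot nf nc w z + cfl_dot nf nc w z'"
  by (simp add: cfl_dot_def lookup_add distrib_left sum.distrib)

lemma cfl_dot_scaleR: "cfl_dot nf nc w (r *\<^sub>R z) = r * cfl_dot nf nc w z"
  by (simp add: cfl_dot_def sum_distrib_left mult.left_commute)

lemma cfl_dot_uminus: "cfl_dot nf nc (\<lambda>v. - w v) z = - cfl_dot nf nc w z"
  by (simp add: cfl_dot_def sum_negf)

lemma convex_cfl_dot_ge: "convex {z. c \<le> cfl_dot nf nc w z}"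
proof (rule convexI)
  fix x y :: cfl_vec and u v :: real
  assume "x \<in> {z. c \<le> cfl_dot nf nc w z}" "y \<in> {z. c \<le> cfl_dot nf nc w z}"
    and uv: "0 \<le> u" "0 \<le> v" "u + v = 1"
  then have "u * c + v * c \<le> u * cfl_dot nf nc w x + v * cfl_dot nf nc w y"
    by (intro add_mono mult_left_mono) auto
  moreover have "u * c + v * c = c"
    using uv by (simp flip: distrib_right)
  ultimately show "u *\<^sub>R x + v *\<^sub>R y \<in> {z. c \<le> cfl_dot nf nc w z}"
    by (simp add: cfl_dot_add cfl_dot_scaleR)
qed

section \<open>What the two conditions on a formulation provide\<close>

text \<open>This is the first condition for the negated row as objective: it is at least
  \<open>- b r\<close> on the solution set, hence also on the polytope.\<close>

lemma cfl_formulation_valid: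
  assumes "cfl_approx_formulation nf nc U g m A b" "z \<in> cfl_polytope nf nc U" "r < m"
  shows "cfl_dot nf nc (A r) z \<le> b r"
proof -
  let ?w = "\<lambda>v. - A r v"
  have "ereal (- b r) \<le> cfl_min nf nc ?w (cfl_solution_set nf nc m A b)"
    unfolding cfl_min_def using \<open>r < m\<close>
    by (intro INF_greatest) (auto simp: cfl_solution_set_def cfl_dot_uminus)
  also have "\<dots> \<le> cfl_min nf nc ?w (cfl_polytope nf nc U)"
    using assms(1) unfolding cfl_approx_formulation_def by blast
  also have "\<dots> \<le> ereal (cfl_dot nf nc ?w z)"
    unfolding cfl_min_def by (rule INF_lower) fact
  finally show ?thesis
    by (simp add: cfl_dot_uminus)
qed

text \<open>A point satisfying all rows would bring the minimum over the solution set below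
  \<open>C / g\<close>, while the bound \<open>C\<close> passes from the integer solutions to their
  hull, against the second condition.\<close>

lemma cfl_formulation_separates:
  assumes form: "cfl_approx_formulation nf nc U g m A b" and "g > 0"
    and w: "w \<in> cfl_admissible nf nc"
    and lower: "\<And>s. s \<in> cfl_int_solutions nf nc U \<Longrightarrow> C \<le> cfl_dot nf nc w s"
    and z: "z \<in> cfl_space nf nc" "g * cfl_dot nf nc w z < C"
  shows "\<exists>r<m. b r < cfl_dot nf nc (A r) z"
proof (rule ccontr)
  assume "\<not> ?thesis"
  then have "z \<in> cfl_solution_set nf nc m A b"
    using z by (simp add: cfl_solution_set_def not_less) (meson not_less)
  have "cfl_polytope nf nc U \<subseteq> {s. C \<le> cfl_dot nf nc w s}"
    unfolding cfl_polytope_def using lower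
    by (intro hull_minimal convex_cfl_dot_ge) auto
  then have "ereal C \<le> cfl_min nf nc w (cfl_polytope nf nc U)"
    unfolding cfl_min_def by (intro INF_greatest) auto
  then have "ereal (inverse g) * ereal C
      \<le> ereal (inverse g) * cfl_min nf nc w (cfl_polytope nf nc U)"
    using \<open>g > 0\<close> by (intro ereal_mult_left_mono) auto
  also have "\<dots> \<le> cfl_min nf nc w (cfl_solution_set nf nc m A b)"
    using form w unfolding cfl_approx_formulation_def by blast
  also have "\<dots> \<le> ereal (cfl_dot nf nc w z)"
    unfolding cfl_min_def by (rule INF_lower) fact
  finally have "C \<le> g * cfl_dot nf nc w z"
    using \<open>g > 0\<close> by (simp add: field_simps)
  with z show False
    by simp
qed

section \<open>Uniform fractional assignments as averages of integer ones\<close>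

text \<open>Clients are handed out in consecutive blocks of lengths \<open>l 0\<close>,
  \<open>l 1\<close> and so on; the induction step gives the new last block to facility
  \<open>n\<close>.\<close>

lemma ex_fun_with_fibres:
  fixes l :: "nat \<Rightarrow> nat"
  shows "\<exists>p. (\<forall>j < sum l {..<n}. p j < n) \<and>
    (\<forall>i<n. card {j. j < sum l {..<n} \<and> p j = i} = l i)"
proof (induction n)
  case 0
  show ?case by simp
next
  case (Suc n)
  then obtain p where p: "\<And>j. j < sum l {..<n} \<Longrightarrow> p j < n"
    "\<And>i. i < n \<Longrightarrow> card {j. j < sum l {..<n} \<and> p j = i} = l i"
    by blast
  define p' where "p' j = (if j < sum l {..<n} then p j else n)" for j
  have "card {j. j < sum l {..<Suc n} \<and> p' j = i} = l i" if "i < Suc n" for i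
  proof (cases "i = n")
    case True
    have eq: "p' j = i \<longleftrightarrow> sum l {..<n} \<le> j" for j
      using p(1)[of j] True by (auto simp: p'_def)
    have "{j. j < sum l {..<Suc n} \<and> p' j = i} = {sum l {..<n} ..< sum l {..<Suc n}}"
      unfolding eq by auto
    then show ?thesis
      using True by simp
  next
    case False
    then have "{j. j < sum l {..<Suc n} \<and> p' j = i} = {j. j < sum l {..<n} \<and> p j = i}"
      by (auto simp: p'_def)
    then show ?thesis
      using p(2)[of i] False that by simp
  qed
  moreover have "p' j < Suc n" for j
    using p(1)[of j] by (auto simp: p'_def)
  ultimately show ?case
    by blast
qed

lemma bij_betw_cyclic_shift:
  "bij_betw (\<lambda>r. (r + s) mod N) {..<N} {..<N}" for N :: nat
proof (cases "N = 0")
  case False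
  have "inj_on (\<lambda>r. (r + s) mod N) {..<N}"
  proof (rule inj_onI)
    fix x y
    assume *: "x \<in> {..<N}" "y \<in> {..<N}" and "(x + s) mod N = (y + s) mod N"
    then obtain q q' where "x + s + N * q = y + s + N * q'"
      by (auto simp: nat_mod_eq_iff)
    then have "x + N * q = y + N * q'"
      by simp
    then have "x mod N = y mod N"
      unfolding nat_mod_eq_iff by blast
    then show "x = y"
      using * by simp
  qed
  moreover have "(\<lambda>r. (r + s) mod N) ` {..<N} \<subseteq> {..<N}"
    using False by auto
  ultimately show ?thesis
    by (simp add: bij_betw_def endo_inj_surj)
qed (simp add: bij_betw_def)

text \<open>All facilities but \<open>e\<close> are fully open, which is free under the objectives
  used below. The entries are affine in \<open>\<eta>\<close> and \<open>l\<close>, so convex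
  combinations of such vectors reduce to those of openings and loads.\<close>

definition load_vec ::
  "nat \<Rightarrow> (nat \<Rightarrow> nat) \<Rightarrow> nat \<Rightarrow> real \<Rightarrow> (nat \<Rightarrow> real) \<Rightarrow> cfl_var \<Rightarrow> real" where
  "load_vec N h e \<eta> l v = (case v of
     Opening i \<Rightarrow> if i = e then \<eta> else 1
   | Assign i j \<Rightarrow> if j < N then l i / real N else of_bool (h j = i))"

lemma load_vec_simps [simp]:
  "load_vec N h e \<eta> l (Opening i) = (if i = e then \<eta> else 1)"
  "load_vec N h e \<eta> l (Assign i j) = (if j < N then l i / real N else of_bool (h j = i))"
  by (simp_all add: load_vec_def)

text \<open>
  An integer assignment of the first \<open>N\<close> clients with loads \<open>l\<close>, averaged over the cyclic shifts
  of these clients, spreads them uniformly.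
\<close>

lemma load_vec_in_polytope:
  assumes N: "0 < N" "N \<le> nc"
    and total: "sum l {..<nf} = N"
    and h: "\<And>j. N \<le> j \<Longrightarrow> j < nc \<Longrightarrow> h j < nf \<and> h j \<noteq> e"
    and cap: "\<And>i. i < nf \<Longrightarrow> l i + card {j. N \<le> j \<and> j < nc \<and> h j = i} \<le> U"
    and \<eta>: "\<eta> = 1 \<or> \<eta> = 0 \<and> l e = 0"
  shows "cfl_vec_of nf nc (load_vec N h e \<eta> (\<lambda>i. real (l i))) \<in> cfl_polytope nf nc U"
proof -
  obtain p where p: "\<And>j. j < N \<Longrightarrow> p j < nf"
    "\<And>i. i < nf \<Longrightarrow> card {j. j < N \<and> p j = i} = l i"
    using ex_fun_with_fibres[of l nf] total by auto
  \<comment> \<open>The summand is symmetric in \<open>j\<close> and \<open>r\<close>: the sum is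
    the load of \<open>i\<close> under a fixed shift \<open>r\<close> and, with the roles exchanged,
    the number of shifts that send a fixed client to \<open>i\<close>.\<close>
  have fibre: "(\<Sum>j<N. of_bool (p ((j + r) mod N) = i)) = real (l i)" if "i < nf" for i r
  proof -
    have "(\<Sum>j<N. of_bool (p ((j + r) mod N) = i)) = (\<Sum>j<N. of_bool (p j = i) :: real)"
      by (rule sum.reindex_bij_betw[OF bij_betw_cyclic_shift])
    also have "\<dots> = real (card {j. j < N \<and> p j = i})"
      by (simp add: of_bool_def sum.If_cases Int_def)
    finally show ?thesis
      using p(2)[OF that] by simp
  qed
  define \<phi> where "\<phi> r j = (if j < N then p ((j + r) mod N) else h j)" for r j
  define f where "f r v = (case v of Opening i \<Rightarrow> if i = e then \<eta> else 1
    | Assign i j \<Rightarrow> of_bool (\<phi> r j = i))" for r v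
  have f_simps: "f r (Opening i) = (if i = e then \<eta> else 1)"
    "f r (Assign i j) = of_bool (\<phi> r j = i)" for r i j
    by (simp_all add: f_def)
  have \<phi>_less: "\<phi> r j < nf" if "j < nc" for r j
    using p(1) h[of j] that N by (auto simp: \<phi>_def)
  \<comment> \<open>A closed \<open>e\<close> has load \<open>0\<close>, so no client below
    \<open>N\<close> is sent there, and \<open>h\<close> avoids \<open>e\<close>.\<close>
  have \<phi>_closed: "\<phi> r j \<noteq> e" if "j < nc" "\<eta> = 0" for r j
  proof (cases "j < N")
    case True
    define x where "x = (j + r) mod N"
    have "x < N"
      using N by (simp add: x_def)
    moreover have "card {j. j < N \<and> p j = e} = 0" if "p x = e"
      using p(2)[of e] p(1)[OF \<open>x < N\<close>] that \<eta> \<open>\<eta> = 0\<close> by auto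
    ultimately have "p x \<noteq> e"
      by auto
    then show ?thesis
      using True by (simp add: \<phi>_def x_def)
  next
    case False
    then show ?thesis
      using h[of j] that by (auto simp: \<phi>_def)
  qed
  have load: "(\<Sum>j<nc. of_bool (\<phi> r j = i)) \<le> real U" if "i < nf" for i r
  proof -
    have "{..<nc} = {..<N} \<union> {N..<nc}" "{..<N} \<inter> {N..<nc} = {}"
      using N by auto
    then have "(\<Sum>j<nc. of_bool (\<phi> r j = i) :: real)
        = (\<Sum>j<N. of_bool (\<phi> r j = i)) + (\<Sum>j\<in>{N..<nc}. of_bool (\<phi> r j = i))"
      by (simp only: sum.union_disjoint finite_lessThan finite_atLeastLessThan)
    also have "(\<Sum>j<N. of_bool (\<phi> r j = i)) = real (l i)"
      using fibre[OF that, of r] by (simp add: \<phi>_def)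
    also have "(\<Sum>j\<in>{N..<nc}. of_bool (\<phi> r j = i)) = (\<Sum>j\<in>{N..<nc}. of_bool (h j = i) :: real)"
      by (intro sum.cong) (auto simp: \<phi>_def)
    also have "\<dots> = real (card {j. N \<le> j \<and> j < nc \<and> h j = i})"
      by (simp add: of_bool_def sum.If_cases Int_def conj_assoc)
    finally show ?thesis
      using cap[OF that] by simp
  qed
  have sol: "cfl_vec_of nf nc (f r) \<in> cfl_int_solutions nf nc U" for r
    unfolding cfl_int_solutions_def
  proof (intro CollectI conjI ballI allI impI cfl_vec_of_in_space)
    fix v assume "v \<in> cfl_vars nf nc"
    then show "Poly_Mapping.lookup (cfl_vec_of nf nc (f r)) v \<in> {0, 1}"
      using \<eta> by (cases v) (auto simp: lookup_cfl_vec_of f_simps)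
  next
    fix j assume "j < nc"
    then show "(\<Sum>i<nf. Poly_Mapping.lookup (cfl_vec_of nf nc (f r)) (Assign i j)) = 1"
      using \<phi>_less[of j r] by (simp add: lookup_cfl_vec_of f_simps of_bool_def)
  next
    fix i j assume "i < nf" "j < nc"
    then show "Poly_Mapping.lookup (cfl_vec_of nf nc (f r)) (Assign i j)
        \<le> Poly_Mapping.lookup (cfl_vec_of nf nc (f r)) (Opening i)"
      using \<eta> \<phi>_closed[of j r] by (auto simp: lookup_cfl_vec_of f_simps)
  next
    fix i assume "i < nf"
    then show "(\<Sum>j<nc. Poly_Mapping.lookup (cfl_vec_of nf nc (f r)) (Assign i j)) \<le> real U"
      using load[of i r] by (simp add: lookup_cfl_vec_of f_simps)
  qed
  have "(\<Sum>r<N. (1 / real N) *\<^sub>R cfl_vec_of nf nc (f r)) \<in> cfl_polytope nf nc U"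
    unfolding cfl_polytope_def using N sol
    by (intro convex_sum convex_convex_hull) (auto intro: hull_inc)
  moreover have "(\<Sum>r<N. (1 / real N) *\<^sub>R cfl_vec_of nf nc (f r))
      = cfl_vec_of nf nc (load_vec N h e \<eta> (\<lambda>i. real (l i)))"
    unfolding cfl_vec_of_scaleR cfl_vec_of_sum
  proof (rule cfl_vec_of_cong, goal_cases)
    case (1 i)
    then show ?case
      using N by (simp add: f_simps)
  next
    case (2 i j)
    then show ?case
      using N fibre[of i j]
      by (auto simp: f_simps \<phi>_def add.commute simp flip: sum_divide_distrib)
  qed
  ultimately show ?thesis
    by simp
qed

section \<open>The gap points and their costs\<close>

text \<open>\<open>G\<close> is the pool from which the sets \<open>S\<close> are drawn; the clients
  from \<open>k * U + 1\<close> on are assigned by \<open>h\<close>. The extra \<open>1\<close>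
  makes \<open>k\<close> full facilities fall short by exactly one client.\<close>

locale cfl_gap_family =
  fixes nf nc U k e :: nat and h :: "nat \<Rightarrow> nat" and G :: "nat set"
  assumes U_pos: "0 < U"
    and clients: "k * U + 1 \<le> nc"
    and e_less: "e < nf"
    and h: "\<And>j. k * U + 1 \<le> j \<Longrightarrow> j < nc \<Longrightarrow> h j < nf \<and> h j \<noteq> e \<and> h j \<notin> G"
    and reserved_load: "\<And>i. card {j. k * U + 1 \<le> j \<and> j < nc \<and> h j = i} \<le> U"
    and G: "G \<subseteq> {..<nf} - {e}"
begin

abbreviation N :: nat where "N \<equiv> k * U + 1"

definition cores :: "nat set set" where
  "cores = {S. S \<subseteq> G \<and> card S = k}"

text \<open>The load \<open>1\<close> of \<open>e\<close> is all that capacity \<open>U\<close>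
  allows at opening \<open>1 / U\<close>; with \<open>k\<close> loads of \<open>U\<close> it adds up
  to \<open>N\<close>.\<close>

definition gap_load :: "nat set \<Rightarrow> nat \<Rightarrow> real" where
  "gap_load S i = (if i \<in> S then real U else of_bool (i = e))"

definition gap_point :: "nat set \<Rightarrow> cfl_vec" where
  "gap_point S = cfl_vec_of nf nc (load_vec N h e (1 / real U) (gap_load S))"

definition gap_cost :: "nat set \<Rightarrow> cfl_var \<Rightarrow> real" where
  "gap_cost S v = (case v of Opening i \<Rightarrow> of_bool (i = e)
    | Assign i j \<Rightarrow> of_bool ((i \<in> insert e S) \<noteq> (j < N)))"

lemma gap_cost_simps [simp]:
  "gap_cost S (Opening i) = of_bool (i = e)"
  "gap_cost S (Assign i j) = of_bool ((i \<in> insert e S) \<noteq> (j < N))"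
  by (simp_all add: gap_cost_def)

lemma finite_G: "finite G"
  using G by (rule finite_subset) simp

text \<open>The connection cost is the distance between two sites, and a path of three edges joining
  different sites must cross over at least once.\<close>

lemma gap_cost_admissible: "gap_cost S \<in> cfl_admissible nf nc"
  by (auto simp: cfl_admissible_def of_bool_def)

text \<open>No assignment crosses between the sites: the first \<open>N\<close> clients use only
  \<open>insert e S\<close>, and \<open>h\<close> avoids \<open>e\<close> and \<open>G\<close>. What
  remains is the opening of \<open>e\<close>.\<close>

lemma gap_cost_gap_point:
  assumes "S \<in> cores"
  shows "cfl_dot nf nc (gap_cost S) (gap_point S) = 1 / real U"
proof -
  have "gap_cost S (Assign i j) * Poly_Mapping.lookup (gap_point S) (Assign i j) = 0"
    if "i < nf" "j < nc" for i j
    using h[of j] that assms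
    by (auto simp: gap_point_def lookup_cfl_vec_of gap_load_def cores_def)
  then have "(\<Sum>i<nf. \<Sum>j<nc. gap_cost S (Assign i j) *
      Poly_Mapping.lookup (gap_point S) (Assign i j)) = 0"
    by (intro sum.neutral ballI) simp
  moreover have "(\<Sum>i<nf. gap_cost S (Opening i) * Poly_Mapping.lookup (gap_point S) (Opening i))
      = (\<Sum>i<nf. if i = e then 1 / real U else 0)"
    by (intro sum.cong) (auto simp: gap_point_def lookup_cfl_vec_of)
  ultimately show ?thesis
    using e_less unfolding cfl_dot_split by simp
qed

text \<open>An open \<open>e\<close> already costs \<open>1\<close>. If it is closed,
  \<open>S\<close> can take at most \<open>k * U\<close> of the first \<open>N\<close> clients, so
  at least one of them pays \<open>1\<close> elsewhere.\<close>

lemma gap_cost_int_solution: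
  assumes S: "S \<in> cores" and z: "z \<in> cfl_int_solutions nf nc U"
  shows "1 \<le> cfl_dot nf nc (gap_cost S) z"
proof -
  let ?y = "\<lambda>i. Poly_Mapping.lookup z (Opening i)"
  let ?x = "\<lambda>i j. Poly_Mapping.lookup z (Assign i j)"
  have bin: "?y i \<in> {0, 1}" "?x i j \<in> {0, 1}" if "i < nf" "j < nc" for i j
    using z that by (auto simp: cfl_int_solutions_def)
  have one: "(\<Sum>i<nf. ?x i j) = 1" if "j < nc" for j
    using z that by (auto simp: cfl_int_solutions_def)
  have open_le: "?x i j \<le> ?y i" if "i < nf" "j < nc" for i j
    using z that by (auto simp: cfl_int_solutions_def)
  have cap: "(\<Sum>j<nc. ?x i j) \<le> real U" if "i < nf" for i
    using z that by (auto simp: cfl_int_solutions_def)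
  have x_nonneg: "0 \<le> ?x i j" if "i < nf" "j < nc" for i j
    using bin(2)[OF that] by auto
  have e_cost: "(\<Sum>i<nf. gap_cost S (Opening i) * ?y i) = ?y e"
    using e_less by (simp add: of_bool_def if_distrib[of "\<lambda>c. c * _"] cong: if_cong)
  have nonneg: "0 \<le> gap_cost S (Assign i j) * ?x i j" if "i < nf" "j < nc" for i j
    using x_nonneg[OF that] by simp
  have "0 < nc"
    using clients by simp
  show ?thesis
  proof (cases "?y e = 0")
    case False
    then have "?y e = 1"
      using bin(1)[of e 0] e_less \<open>0 < nc\<close> by auto
    moreover have "0 \<le> (\<Sum>i<nf. \<Sum>j<nc. gap_cost S (Assign i j) * ?x i j)"
      by (intro sum_nonneg nonneg) auto
    ultimately show ?thesis
      unfolding cfl_dot_split e_cost by simp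
  next
    case True
    have S': "S \<subseteq> {..<nf}" "e \<notin> S" "finite S" "card S = k"
      using S G finite_subset[OF _ finite_G] by (auto simp: cores_def)
    have D: "{..<N} \<subseteq> {..<nc}"
      using clients by auto
    have "(\<Sum>i<nf. \<Sum>j<N. ?x i j) = (\<Sum>j<N. \<Sum>i<nf. ?x i j)"
      by (rule sum.swap)
    also have "\<dots> = real N"
      using one clients by simp
    finally have "real N = (\<Sum>i<nf. \<Sum>j<N. ?x i j)" ..
    \<comment> \<open>Facility by facility: clients served outside \<open>insert e S\<close> are
      paid for, those served in \<open>S\<close> are bounded by the capacity, and a closed
      \<open>e\<close> serves none.\<close>
    also have "\<dots> \<le> (\<Sum>i<nf. (\<Sum>j<nc. gap_cost S (Assign i j) * ?x i j)
        + (if i \<in> S then real U else 0))"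
    proof (rule sum_mono)
      fix i assume "i \<in> {..<nf}"
      then have i: "i < nf" by simp
      have le: "(\<Sum>j<N. ?x i j) \<le> (\<Sum>j<nc. ?x i j)"
        by (rule sum_mono2) (use D x_nonneg[OF i] in auto)
      consider "i \<in> S" | "i = e" | "i \<notin> S" "i \<noteq> e" by blast
      then show "(\<Sum>j<N. ?x i j) \<le> (\<Sum>j<nc. gap_cost S (Assign i j) * ?x i j)
        + (if i \<in> S then real U else 0)"
      proof cases
        case 1
        have "0 \<le> (\<Sum>j<nc. gap_cost S (Assign i j) * ?x i j)"
          by (intro sum_nonneg nonneg) (use i in auto)
        then show ?thesis
          using le cap[OF i] 1 by simp
      next
        case 2
        have "?x i j = 0" if "j < nc" for j
          using open_le[OF i that] x_nonneg[OF i that] 2 True by simp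
        then show ?thesis
          using 2 S' clients by simp
      next
        case 3
        have "(\<Sum>j<N. ?x i j) = (\<Sum>j<N. gap_cost S (Assign i j) * ?x i j)"
          using 3 by (intro sum.cong) auto
        also have "\<dots> \<le> (\<Sum>j<nc. gap_cost S (Assign i j) * ?x i j)"
          by (rule sum_mono2) (use D nonneg[OF i] in \<open>auto simp del: gap_cost_simps\<close>)
        finally show ?thesis
          using 3 by simp
      qed
    qed
    also have "\<dots> = (\<Sum>i<nf. \<Sum>j<nc. gap_cost S (Assign i j) * ?x i j) + real (k * U)"
      using S' by (simp add: sum.distrib sum.If_cases Int_absorb1)
    finally show ?thesis
      unfolding cfl_dot_split e_cost using True by simp
  qed
qed

section \<open>Integer loads with \<open>e\<close> closed or open, and midpoints\<close>

text \<open>\<open>h\<close> avoids \<open>insert e G\<close> and \<open>l\<close> vanishes outside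
  it, so no facility carries both kinds of load and the capacity is checked for each kind
  separately.\<close>

lemma reserved_load_vec_in_polytope:
  assumes "sum l {..<nf} = N" and "\<And>i. l i \<le> U" and "\<And>i. i \<notin> insert e G \<Longrightarrow> l i = 0"
    and "\<eta> = 1 \<or> \<eta> = 0 \<and> l e = 0"
  shows "cfl_vec_of nf nc (load_vec N h e \<eta> (\<lambda>i. real (l i))) \<in> cfl_polytope nf nc U"
proof (rule load_vec_in_polytope)
  fix i
  show "l i + card {j. N \<le> j \<and> j < nc \<and> h j = i} \<le> U"
  proof (cases "i \<in> insert e G")
    case True
    then have "{j. N \<le> j \<and> j < nc \<and> h j = i} = {}"
      using h by auto
    then show ?thesis
      using assms(2)[of i] by (simp only: card.empty)
  next
    case False
    then show ?thesis
      using assms(3)[of i] reserved_load[of i] by simp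
  qed
qed (use assms h clients in auto)

text \<open>\<open>closed_load\<close> and \<open>open_load\<close> both have \<open>k\<close> full
  facilities and one left-over client. With \<open>e\<close> closed, the full ones are
  \<open>S\<close> and the client goes to some \<open>t\<close> outside \<open>S\<close>; with
  \<open>e\<close> open, \<open>e\<close> replaces \<open>s\<close> in \<open>S\<close>, and
  \<open>s\<close> keeps only that client.\<close>

definition closed_load :: "nat set \<Rightarrow> nat \<Rightarrow> nat \<Rightarrow> nat" where
  "closed_load S t i = (if i \<in> S then U else 0) + (if i = t then 1 else 0)"

definition open_load :: "nat set \<Rightarrow> nat \<Rightarrow> nat \<Rightarrow> nat" where
  "open_load S s i = (if i \<in> insert e (S - {s}) then U else 0) + (if i = s then 1 else 0)"

lemma coresD:
  assumes "S \<in> cores"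
  shows "S \<subseteq> G" "e \<notin> S" "finite S" "card S = k" "S \<inter> {..<nf} = S"
  using assms G finite_subset[OF _ finite_G] by (auto simp: cores_def)

lemma closed_load_in_polytope:
  assumes S: "S \<in> cores" and t: "t \<in> G - S"
  shows "cfl_vec_of nf nc (load_vec N h e 0 (\<lambda>i. real (closed_load S t i)))
    \<in> cfl_polytope nf nc U"
proof (rule reserved_load_vec_in_polytope)
  show "sum (closed_load S t) {..<nf} = N"
    using coresD[OF S] t G
    by (auto simp: closed_load_def sum.distrib sum.If_cases Int_commute)
qed (use coresD[OF S] t G U_pos in \<open>auto simp: closed_load_def\<close>)

lemma open_load_in_polytope:
  assumes S: "S \<in> cores" and s: "s \<in> S"
  shows "cfl_vec_of nf nc (load_vec N h e 1 (\<lambda>i. real (open_load S s i)))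
    \<in> cfl_polytope nf nc U"
proof (rule reserved_load_vec_in_polytope)
  have "insert e (S - {s}) \<inter> {..<nf} = insert e (S - {s})" "s < nf"
    using coresD[OF S] s G e_less by auto
  moreover have "card (insert e (S - {s})) = k"
  proof -
    have "card (insert e (S - {s})) = Suc (card (S - {s}))"
      by (rule card_insert_disjoint) (simp_all add: coresD(2,3)[OF S])
    also have "\<dots> = k"
      using card_Suc_Diff1[OF coresD(3)[OF S] s] coresD(4)[OF S] by (rule trans)
    finally show ?thesis .
  qed
  ultimately show "sum (open_load S s) {..<nf} = N"
    by (simp add: open_load_def sum.distrib sum.If_cases Int_commute del: insert_iff)
qed (use coresD[OF S] s G U_pos in \<open>auto simp: open_load_def\<close>)

text \<open>
  Facility \<open>e\<close> is open with probability \<open>1 / U\<close> and then carries the full load \<open>U\<close>; in both cases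
  two facilities \<open>s \<in> S - T\<close> and \<open>t \<in> T - S\<close> absorb the difference between the loads.
\<close>

lemma gap_point_midpoint:
  assumes S: "S \<in> cores" and T: "T \<in> cores" and "S \<noteq> T"
  shows "(1/2) *\<^sub>R gap_point S + (1/2) *\<^sub>R gap_point T \<in> cfl_polytope nf nc U"
proof -
  note ST = coresD[OF S] coresD[OF T]
  obtain s where s: "s \<in> S" "s \<notin> T"
    using ST \<open>S \<noteq> T\<close> card_subset_eq[of T S] by auto
  obtain t where t: "t \<in> T" "t \<notin> S"
    using ST \<open>S \<noteq> T\<close> card_subset_eq[of S T] by auto
  \<comment> \<open>The weight of the points with \<open>e\<close> open: it gives \<open>e\<close>
    the mean opening \<open>1 / U\<close> and the mean load \<open>1\<close>, as in
    \<open>gap_point\<close>.\<close>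
  define \<delta> where "\<delta> = 1 / real U"
  have \<delta>: "0 \<le> \<delta>" "\<delta> \<le> 1" "real U * \<delta> = 1" "\<delta> * real U = 1"
    using U_pos by (auto simp: \<delta>_def)
  define c where "c S t = cfl_vec_of nf nc (load_vec N h e 0 (\<lambda>i. real (closed_load S t i)))" for S t
  define d where "d S s = cfl_vec_of nf nc (load_vec N h e 1 (\<lambda>i. real (open_load S s i)))" for S s
  have conv: "convex (cfl_polytope nf nc U)"
    by (simp add: cfl_polytope_def)
  have mix: "(1 - \<delta>) *\<^sub>R x + \<delta> *\<^sub>R y \<in> cfl_polytope nf nc U"
    if "x \<in> cfl_polytope nf nc U" "y \<in> cfl_polytope nf nc U" for x y
    using \<delta>(1,2) that by (intro convexD[OF conv]) auto
  have "s \<in> G - T" "t \<in> G - S"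
    using ST s t by auto
  then have "(1 - \<delta>) *\<^sub>R c S t + \<delta> *\<^sub>R d S s \<in> cfl_polytope nf nc U"
    "(1 - \<delta>) *\<^sub>R c T s + \<delta> *\<^sub>R d T t \<in> cfl_polytope nf nc U"
    unfolding c_def d_def using S T s t
    by (intro mix closed_load_in_polytope open_load_in_polytope; simp)+
  then have "(1/2) *\<^sub>R ((1 - \<delta>) *\<^sub>R c S t + \<delta> *\<^sub>R d S s)
      + (1/2) *\<^sub>R ((1 - \<delta>) *\<^sub>R c T s + \<delta> *\<^sub>R d T t) \<in> cfl_polytope nf nc U"
    by (rule convexD[OF conv]) auto
  also have "(1/2) *\<^sub>R ((1 - \<delta>) *\<^sub>R c S t + \<delta> *\<^sub>R d S s)
      + (1/2) *\<^sub>R ((1 - \<delta>) *\<^sub>R c T s + \<delta> *\<^sub>R d T t)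
      = (1/2) *\<^sub>R gap_point S + (1/2) *\<^sub>R gap_point T"
    unfolding c_def d_def gap_point_def cfl_vec_of_scaleR cfl_vec_of_add
  proof (rule cfl_vec_of_cong, goal_cases)
    case (1 i)
    then show ?case
      by (simp add: \<delta>_def)
  next
    case (2 i j)
    have \<delta>': "(1 - \<delta>) * real U = real U - 1"
      using \<delta> by (simp add: left_diff_distrib)
    \<comment> \<open>Relative to \<open>gap_load\<close>, the mixture for \<open>S\<close> has
      \<open>1 - \<delta>\<close> too little at \<open>s\<close> and as much too much at
      \<open>t\<close>. The mixture for \<open>T\<close> errs the other way round, so the midpoint
      is exact.\<close>
    consider "i = e" | "i = s" | "i = t" | "i \<notin> {e, s, t}" "i \<in> S" "i \<in> T"
      | "i \<notin> {e, s, t}" "i \<in> S" "i \<notin> T" | "i \<notin> {e, s, t}" "i \<notin> S" "i \<in> T"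
      | "i \<notin> {e, s, t}" "i \<notin> S" "i \<notin> T"
      by blast
    then have load: "(1/2) * ((1 - \<delta>) * real (closed_load S t i) + \<delta> * real (open_load S s i))
        + (1/2) * ((1 - \<delta>) * real (closed_load T s i) + \<delta> * real (open_load T t i))
        = (1/2) * gap_load S i + (1/2) * gap_load T i"
    proof cases
      case 1
      then have "i \<notin> S" "i \<notin> T" "i \<noteq> s" "i \<noteq> t"
        using ST s t by auto
      with 1 show ?thesis
        using \<delta> by (simp add: closed_load_def open_load_def gap_load_def)
    next
      case 2
      then have "i \<in> S" "i \<notin> T" "i \<noteq> e" "i \<noteq> t"
        using ST s t by auto
      with 2 show ?thesis
        using \<delta>' by (simp add: closed_load_def open_load_def gap_load_def field_simps)
    next
      case 3
      then have "i \<notin> S" "i \<in> T" "i \<noteq> e" "i \<noteq> s"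
        using ST s t by auto
      with 3 show ?thesis
        using \<delta>' by (simp add: closed_load_def open_load_def gap_load_def field_simps)
    qed (use \<delta>(4) \<delta>' in \<open>simp_all add: closed_load_def open_load_def gap_load_def\<close>)
    have scale: "(1/2) * ((1 - \<delta>) * (p / M) + \<delta> * (q / M))
        + (1/2) * ((1 - \<delta>) * (p' / M) + \<delta> * (q' / M))
        = ((1/2) * ((1 - \<delta>) * p + \<delta> * q) + (1/2) * ((1 - \<delta>) * p' + \<delta> * q')) / M"
      for p q p' q' M :: real
      by (simp add: add_divide_distrib)
    show ?case
    proof (cases "j < N")
      case True
      then show ?thesis
        by (simp only: load_vec_simps if_True scale load) (simp add: add_divide_distrib)
    next
      case False
      then show ?thesis
        by (simp add: left_diff_distrib)
    qed
  qed
  finally show ?thesis .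
qed

section \<open>Counting the violated rows\<close>

text \<open>Each \<open>S\<close> in \<open>cores\<close> picks a row violated at its gap point. A
  row picked twice would also be violated at the midpoint, so the choice is injective.\<close>

theorem card_cores_le_constraints:
  assumes form: "cfl_approx_formulation nf nc U g m A b" and g: "0 < g" "g < real U"
  shows "card G choose k \<le> m"
proof -
  have "\<forall>S\<in>cores. \<exists>r. r < m \<and> b r < cfl_dot nf nc (A r) (gap_point S)"
  proof
    fix S assume S: "S \<in> cores"
    show "\<exists>r<m. b r < cfl_dot nf nc (A r) (gap_point S)"
    proof (rule cfl_formulation_separates[OF form g(1) gap_cost_admissible])
      show "gap_point S \<in> cfl_space nf nc"
        by (simp add: gap_point_def cfl_vec_of_in_space)
      \<comment> \<open>The fractional cost is \<open>1 / U\<close> against the integral bound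
        \<open>1\<close>; here \<open>g < U\<close> enters.\<close>
      show "g * cfl_dot nf nc (gap_cost S) (gap_point S) < 1"
        using g by (simp add: gap_cost_gap_point[OF S])
    qed (rule gap_cost_int_solution[OF S])
  qed
  then obtain r where r: "\<forall>S\<in>cores. r S < m \<and> b (r S) < cfl_dot nf nc (A (r S)) (gap_point S)"
    by (rule bchoice[THEN exE])
  have "inj_on r cores"
  proof (rule inj_onI, rule ccontr)
    fix S T assume S: "S \<in> cores" and T: "T \<in> cores" and eq: "r S = r T" and "S \<noteq> T"
    have "r S < m"
      using r S by blast
    then have "cfl_dot nf nc (A (r S)) ((1/2) *\<^sub>R gap_point S + (1/2) *\<^sub>R gap_point T) \<le> b (r S)"
      by (rule cfl_formulation_valid[OF form gap_point_midpoint[OF S T \<open>S \<noteq> T\<close>]])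
    moreover have "b (r S) < cfl_dot nf nc (A (r S)) (gap_point S)"
      "b (r S) < cfl_dot nf nc (A (r S)) (gap_point T)"
      using r S T eq by auto
    ultimately show False
      unfolding cfl_dot_add cfl_dot_scaleR by linarith
  qed
  moreover have "r ` cores \<subseteq> {..<m}"
    using r by auto
  ultimately have "card cores \<le> card {..<m}"
    by (rule card_inj_on_le) simp
  then show ?thesis
    by (simp add: cores_def n_subsets[OF finite_G])
qed

end

section \<open>The instance and the asymptotics\<close>

text \<open>The \<open>a * n^4\<close> clients form \<open>a * n\<close> blocks of length
  \<open>n^3\<close>, block \<open>i\<close> belonging to facility \<open>i\<close>. So the reserved
  facilities lie below \<open>a * n\<close>, \<open>e\<close> is the next one, and all later ones
  form the pool. The first \<open>n^4 + 1\<close> clients are those to be spread.\<close>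

lemma cfl_gap_family_instance:
  fixes a n :: nat
  assumes "2 \<le> a" and n6: "6 \<le> n" and square: "2 * (a * n) + 2 * n \<le> n^2"
  shows "cfl_gap_family (n^2) (a * n^4) (n^3) n (a * n) (\<lambda>j. j div n^3) {a * n<..<n^2}"
proof
  show "0 < n^3" "a * n < n^2" "{a * n<..<n^2} \<subseteq> {..<n^2} - {a * n}"
    using n6 square by auto
  have "0 < n^4"
    using n6 by simp
  moreover have "n * n^3 = n^4"
    by (simp add: power4_eq_xxxx power3_eq_cube)
  moreover have "2 * n^4 \<le> a * n^4"
    using \<open>a \<ge> 2\<close> by (rule mult_right_mono) simp
  ultimately show "n * n^3 + 1 \<le> a * n^4"
    by linarith
next
  fix j assume "j < a * n^4"
  then have "j < n^3 * (a * n)"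
    by (simp add: power4_eq_xxxx power3_eq_cube algebra_simps)
  then have "j div n^3 < a * n"
    by (simp add: less_mult_imp_div_less mult.commute)
  then show "j div n^3 < n^2 \<and> j div n^3 \<noteq> a * n \<and> j div n^3 \<notin> {a * n<..<n^2}"
    using square by auto
next
  fix i
  have "0 < n^3"
    using n6 by simp
  then have "{j. n * n^3 + 1 \<le> j \<and> j < a * n^4 \<and> j div n^3 = i} \<subseteq> {i * n^3..<i * n^3 + n^3}"
    by (auto simp: dividend_less_div_times add.commute)
  then have "card {j. n * n^3 + 1 \<le> j \<and> j < a * n^4 \<and> j div n^3 = i}
      \<le> card {i * n^3..<i * n^3 + n^3}"
    by (intro card_mono) auto
  then show "card {j. n * n^3 + 1 \<le> j \<and> j < a * n^4 \<and> j div n^3 = i} \<le> n^3"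
    by simp
qed

text \<open>With \<open>k = n\<close> and a pool of size \<open>M \<ge> n^2 / 2\<close> the count is
  at least \<open>M choose n\<close>, hence at least
  \<open>(M / n)^n \<ge> (n / 2)^n \<ge> sqrt n ^ n\<close>. The last term is
  \<open>2 powr (n * log 2 n / 2)\<close>, whence \<open>c = 1/2\<close>.\<close>

theorem theorem4p1:
  fixes a :: nat and g :: real
  assumes "a \<ge> 2" and "g > 0"
  shows "\<exists>c::real. c > 0 \<and> (\<exists>n0::nat. \<forall>n\<ge>n0.
           \<forall>(m::nat) (A :: nat \<Rightarrow> cfl_var \<Rightarrow> real) (b :: nat \<Rightarrow> real).
             cfl_approx_formulation (n^2) (a * n^4) (n^3) g m A b \<longrightarrow>
               real m \<ge> 2 powr (c * real n * log 2 (real n)))"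
proof (intro exI[of _ "1/2 :: real"] exI[of _ "2 * a + 2 + nat \<lceil>g\<rceil>"] conjI allI impI)
  show "0 < (1/2 :: real)"
    by simp
next
  fix n m :: nat and A :: "nat \<Rightarrow> cfl_var \<Rightarrow> real" and b :: "nat \<Rightarrow> real"
  assume n: "2 * a + 2 + nat \<lceil>g\<rceil> \<le> n"
    and form: "cfl_approx_formulation (n^2) (a * n^4) (n^3) g m A b"
  \<comment> \<open>The threshold is chosen for these bounds: \<open>2 * a + 2\<close> leaves at
    least half of the facilities for the pool, and the part from \<open>g\<close> makes
    \<open>g\<close> smaller than the capacity \<open>n^3\<close>.\<close>
  have n6: "6 \<le> n" and an: "2 * a + 2 \<le> n" and "g \<le> real n"
    using n \<open>a \<ge> 2\<close> by linarith+
  have "(2 * a + 2) * n \<le> n * n"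
    using an by (rule mult_right_mono) simp
  then have square: "2 * (a * n) + 2 * n \<le> n^2"
    by (simp add: power2_eq_square algebra_simps)
  have "real n ^ 1 < real n ^ 3"
    using n6 by (intro power_strict_increasing) auto
  then have "g < real (n^3)"
    using \<open>g \<le> real n\<close> unfolding of_nat_power power_one_right by linarith
  have "card {a * n<..<n^2} choose n \<le> m"
    using cfl_gap_family_instance[OF \<open>a \<ge> 2\<close> n6 square] form \<open>g > 0\<close> \<open>g < real (n^3)\<close>
    by (rule cfl_gap_family.card_cores_le_constraints)
  define M where "M = card {a * n<..<n^2}"
  have "n^2 \<le> 2 * M"
    using square n6 by (simp add: M_def)
  moreover have "n^2 = n * n"
    by (rule power2_eq_square)
  ultimately have "real (n * n) \<le> real (2 * M)"
    by (simp only: of_nat_le_iff)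
  then have M: "real n * real n \<le> 2 * real M"
    by simp
  have "2 * n \<le> n * n"
    using n6 by (intro mult_right_mono) auto
  then have "n \<le> M"
    using \<open>n^2 \<le> 2 * M\<close> \<open>n^2 = n * n\<close> by linarith
  \<comment> \<open>Weakening \<open>n / 2\<close> to \<open>sqrt n\<close> absorbs the factor
    \<open>1/2\<close> at the price of half the exponent.\<close>
  have "2 * sqrt (real n) \<le> sqrt (real n) * sqrt (real n)"
    using n6 by (intro mult_right_mono real_le_rsqrt) auto
  then have "sqrt (real n) \<le> real n / 2"
    by simp
  also have "real n / 2 \<le> real M / real n"
    using M n6 by (simp add: field_simps)
  finally have "sqrt (real n) ^ n \<le> (real M / real n) ^ n"
    by (intro power_mono) auto
  also have "\<dots> \<le> real (M choose n)"
    using binomial_ge_n_over_k_pow_k[OF \<open>n \<le> M\<close>, where 'a = real] by simp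
  also have "\<dots> \<le> real m"
    using \<open>card {a * n<..<n^2} choose n \<le> m\<close> by (simp add: M_def)
  finally have "sqrt (real n) ^ n \<le> real m" .
  also have "sqrt (real n) ^ n = (real n powr (1/2)) powr real n"
    using n6 by (simp add: powr_half_sqrt powr_realpow)
  also have "\<dots> = (2 powr log 2 (real n)) powr (1/2 * real n)"
    using n6 by (simp add: powr_powr)
  also have "\<dots> = 2 powr (1/2 * real n * log 2 (real n))"
    by (simp only: powr_powr mult.commute)
  finally show "2 powr (1/2 * real n * log 2 (real n)) \<le> real m" .
qed

end
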